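(* Let $\Omega\subset\mathbb{R}^2$ be an open set containing the origin, and let $u$ be a subharmonic function on $\Omega$. Suppose that the first partial derivatives $u_x$ and $u_y$ exist at every point of $\Omega$ lying on the coordinate axes $\{(x,y): y=0\}\cup\{(x,y): x=0\}$, and that the second partial derivatives $u_{xx}$ and $u_{yy}$ exist at the origin. Then $$u_{xx}(0,0)+u_{yy}(0,0)\geq 0.$$
   Context: Subharmonic functions are understood in the usual sense: upper semicontinuous functions with values in $[-\infty,\infty)$, satisfying the sub-mean value inequality; no continuity or smoothness is assumed. Partial derivatives are ordinary pointwise (finite) derivatives: $u_{xx}(0,0)$ is the derivative at $x=0$ of the function $x\mapsto u_x(x,0)$, and $u_{yy}(0,0)$ is the derivative at $y=0$ of the function $y\mapsto u_y(0,y)$. No continuity of any partial derivative is assumed. *)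

theory Defs
  imports "HOL-Analysis.Analysis"
begin

definition usc_on :: "'a::topological_space set \<Rightarrow> ('a \<Rightarrow> ereal) \<Rightarrow> bool" where
  "usc_on S f \<longleftrightarrow> (\<forall>p\<in>S. \<forall>c. f p < c \<longrightarrow> (\<forall>\<^sub>F q in at p within S. f q < c))"

(* Lebesgue integral of an extended real function as (integral of positive part)
   minus (integral of negative part): e2ennreal sends negative values to 0.
   It is only used for functions that are bounded above on a finite measure space,
   so the first term is finite and the value lies in [-\<infinity>, \<infinity>). *)
definition ereal_integral :: "'a measure \<Rightarrow> ('a \<Rightarrow> ereal) \<Rightarrow> ereal" where
  "ereal_integral M f =
     enn2ereal (\<integral>\<^sup>+ x. e2ennreal (f x) \<partial>M) - enn2ereal (\<integral>\<^sup>+ x. e2ennreal (- f x) \<partial>M)"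

definition circle_mean :: "(real \<times> real \<Rightarrow> ereal) \<Rightarrow> real \<times> real \<Rightarrow> real \<Rightarrow> ereal" where
  "circle_mean u p r =
     ereal (1 / (2 * pi)) *
     ereal_integral (restrict_space lborel {0..2 * pi})
       (\<lambda>t. u (fst p + r * cos t, snd p + r * sin t))"

(* The function identically -\<infinity> is not excluded.
   The metric on real \<times> real is the Euclidean one, so cball is a round disc. *)
definition subharmonic_on :: "(real \<times> real) set \<Rightarrow> (real \<times> real \<Rightarrow> ereal) \<Rightarrow> bool" where
  "subharmonic_on \<Omega> u \<longleftrightarrow>
     (\<forall>p\<in>\<Omega>. u p < \<infinity>) \<and>
     usc_on \<Omega> u \<and>
     (\<forall>p r. 0 < r \<and> cball p r \<subseteq> \<Omega> \<longrightarrow> u p \<le> circle_mean u p r)"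

(* Finite derivative of an extended real valued function. Convergence of the difference
   quotients to a finite limit forces f to be finite near x, so real_of_ereal (which sends
   infinite values to 0) does not change the values that matter. *)
definition has_finite_derivative :: "(real \<Rightarrow> ereal) \<Rightarrow> real \<Rightarrow> real \<Rightarrow> bool" where
  "has_finite_derivative f D x \<longleftrightarrow>
     (\<forall>\<^sub>F s in nhds x. \<bar>f s\<bar> \<noteq> \<infinity>) \<and>
     ((\<lambda>s. real_of_ereal (f s)) has_real_derivative D) (at x)"

definition has_partial_x :: "(real \<times> real \<Rightarrow> ereal) \<Rightarrow> real \<Rightarrow> real \<times> real \<Rightarrow> bool" where
  "has_partial_x u D p \<longleftrightarrow> has_finite_derivative (\<lambda>s. u (s, snd p)) D (fst p)"

definition has_partial_y :: "(real \<times> real \<Rightarrow> ereal) \<Rightarrow> real \<Rightarrow> real \<times> real \<Rightarrow> bool" where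
  "has_partial_y u D p \<longleftrightarrow> has_finite_derivative (\<lambda>s. u (fst p, s)) D (snd p)"

end

theory Submission
  imports Defs "HOL-Complex_Analysis.Complex_Analysis"
begin

text \<open>If $u_{xx} + u_{yy} < 0$ at the origin, subtracting a harmonic quadratic polynomial makes the two
  second derivatives equal and negative, so that $u(0) = 0$ and $u \le -3 c |z|^2$ on both axes near
  $0$. Rotate a quadrant to the sector $|\arg z| \le \pi/4$. There the harmonic function
  $-(4/\pi) \mathrm{Re}(z^2 \log z)$ equals $|z|^2$ on the two edges, but is of size
  $|z|^2 \log(1/|z|)$ inside. By the maximum principle,
  $u \le (4c/\pi) \mathrm{Re}(z^2 \log z) + k \mathrm{Re}(z^2) - c |z|^2$ in the sector, where $k$
  takes care of the circular arc. Near $0$ the logarithm beats $k$, whence $u \le -c |z|^2$ in all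
  four quadrants. This contradicts the sub-mean value inequality at $0$.\<close>

section \<open>Circle means and the mean value property\<close>

lemma ereal_integral_mono:
  assumes "\<And>x. x \<in> space M \<Longrightarrow> f x \<le> g x"
  shows "ereal_integral M f \<le> ereal_integral M g"
  unfolding ereal_integral_def
  by (intro ereal_minus_mono less_eq_ennreal.rep_eq[THEN iffD1] nn_integral_mono e2ennreal_mono)
     (use assms in \<open>auto simp: ereal_minus_le_minus\<close>)

lemma ereal_integral_ereal:
  assumes "integrable M f"
  shows "ereal_integral M (\<lambda>x. ereal (f x)) = ereal (integral\<^sup>L M f)"
proof -
  obtain a where a: "(\<integral>\<^sup>+ x. ennreal (f x) \<partial>M) = ennreal a" "a \<ge> 0"
    using assms unfolding real_integrable_def
    by (metis ennreal_cases infinity_ennreal_def)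
  obtain b where b: "(\<integral>\<^sup>+ x. ennreal (- f x) \<partial>M) = ennreal b" "b \<ge> 0"
    using assms unfolding real_integrable_def
    by (metis ennreal_cases infinity_ennreal_def)
  show ?thesis
    using a b by (simp add: ereal_integral_def real_lebesgue_integral_def[OF assms] e2ennreal_ereal enn2ereal_ennreal)
qed

text \<open>All later estimates reach the circle mean of \<open>u\<close> through a continuous
  majorant on the circle, so the extended integral of \<open>u\<close> itself is never
  evaluated.\<close>

lemma circle_mean_le:
  assumes H: "continuous_on {0..2 * pi} H"
    and le: "\<And>t. t \<in> {0..2 * pi} \<Longrightarrow> u (fst p + r * cos t, snd p + r * sin t) \<le> ereal (H t)"
  shows "circle_mean u p r \<le> ereal (integral {0..2 * pi} H / (2 * pi))"
proof -
  let ?M = "restrict_space lborel {0..2 * pi}"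
  have si: "set_integrable lborel {0..2 * pi} H"
    unfolding set_integrable_def using borel_integrable_compact[OF _ H]
    by (simp add: indicator_scaleR_eq_if)
  have int: "integrable ?M H"
    using si unfolding set_integrable_def by (simp add: integrable_restrict_space)
  have eq: "integral\<^sup>L ?M H = integral {0..2 * pi} H"
    using set_borel_integral_eq_integral(2)[OF si]
    by (simp add: integral_restrict_space set_lebesgue_integral_def)
  have "ereal_integral ?M (\<lambda>t. u (fst p + r * cos t, snd p + r * sin t)) \<le> ereal_integral ?M (\<lambda>t. ereal (H t))"
    using le by (intro ereal_integral_mono) (auto simp: space_restrict_space)
  then have "circle_mean u p r \<le> ereal (1 / (2 * pi)) * ereal (integral {0..2 * pi} H)"
    unfolding circle_mean_def ereal_integral_ereal[OF int] eq
    by (intro ereal_mult_left_mono) auto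
  then show ?thesis by simp
qed

text \<open>Cauchy's formula at the centre: the derivative of the circle cancels the kernel
  \<open>1 / (w - p)\<close> up to the factor \<open>\<i>\<close>. Real parts give the mean value
  property of harmonic functions.\<close>

lemma holomorphic_mean_value:
  assumes "F holomorphic_on ball p r'" "0 < r" "r < r'"
  shows "((\<lambda>t. Re (F (p + of_real r * cis t))) has_integral 2 * pi * Re (F p)) {0..2 * pi}"
proof -
  have sub: "cball p r \<subseteq> ball p r'" using assms by auto
  have hol: "F holomorphic_on cball p r" using assms(1) sub holomorphic_on_subset by blast
  have "((\<lambda>w. F w / (w - p)) has_contour_integral (2 * of_real pi * \<i> * F p)) (circlepath p r)"
    using Cauchy_integral_circlepath_simple[OF hol, of p] \<open>0 < r\<close> by simp
  then have "((\<lambda>t. F (p + of_real r * cis t) / (p + of_real r * cis t - p) * of_real r * \<i> * cis t)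
      has_integral (2 * of_real pi * \<i> * F p)) {0..2 * pi}"
    unfolding circlepath_def by (subst (asm) has_contour_integral_part_circlepath_iff) auto
  then have "((\<lambda>t. \<i> * F (p + of_real r * cis t)) has_integral (2 * of_real pi * \<i> * F p)) {0..2 * pi}"
    using \<open>0 < r\<close> by (simp add: field_simps)
  then have "((\<lambda>t. (- \<i>) * (\<i> * F (p + of_real r * cis t))) has_integral (- \<i>) * (2 * of_real pi * \<i> * F p)) {0..2 * pi}"
    by (rule has_integral_mult_right)
  then have "((\<lambda>t. F (p + of_real r * cis t)) has_integral (2 * of_real pi * F p)) {0..2 * pi}"
    by (simp add: algebra_simps)
  from has_integral_Re[OF this] show ?thesis by simp
qed

section \<open>The function z^2 log z in the right half-plane\<close>

text \<open>The origin is included because it is the apex of the closed sector used later. There the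
  square beats the logarithm: the modulus is at most
  \<open>(norm z)\<^sup>2 * (\<bar>ln (norm z)\<bar> + pi)\<close>, which tends to 0.\<close>

lemma continuous_on_power2_times_Ln:
  "continuous_on {z. Re z > 0 \<or> z = 0} (\<lambda>z. z\<^sup>2 * Ln z)"
proof (rule continuous_at_imp_continuous_on, rule ballI)
  fix z assume z: "z \<in> {z. Re z > 0 \<or> z = 0}"
  show "isCont (\<lambda>z. z\<^sup>2 * Ln z) z"
  proof (cases "z = 0")
    case True
    have fl: "filterlim (norm :: complex \<Rightarrow> real) (at_right 0) (at 0)"
      by (auto simp: filterlim_at intro!: tendsto_eq_intros eventually_at_leftI eventually_at_filter[THEN iffD2])
    have "((\<lambda>x::real. x\<^sup>2 * (\<bar>ln x\<bar> + pi)) \<longlongrightarrow> 0) (at_right 0)" by real_asymp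
    from filterlim_compose[OF this fl]
    have lim: "((\<lambda>z::complex. (norm z)\<^sup>2 * (\<bar>ln (norm z)\<bar> + pi)) \<longlongrightarrow> 0) (at 0)" .
    have bd: "norm (w\<^sup>2 * Ln w) \<le> (norm w)\<^sup>2 * (\<bar>ln (norm w)\<bar> + pi)" if "w \<noteq> 0" for w
    proof -
      have "norm (Ln w) \<le> \<bar>Re (Ln w)\<bar> + \<bar>Im (Ln w)\<bar>" by (rule cmod_le)
      also have "\<dots> \<le> \<bar>ln (norm w)\<bar> + pi"
        using that mpi_less_Im_Ln[OF that] Im_Ln_le_pi[OF that] by (simp add: abs_le_iff)
      finally show ?thesis by (simp add: norm_mult norm_power mult_left_mono)
    qed
    have "((\<lambda>z. z\<^sup>2 * Ln z) \<longlongrightarrow> 0) (at 0)"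
      by (rule Lim_null_comparison[OF _ lim]) (auto simp: eventually_at_filter bd)
    with True show ?thesis by (simp add: isCont_def)
  next
    case False
    with z have "z \<notin> \<real>\<^sub>\<le>\<^sub>0" by (auto simp: complex_nonpos_Reals_iff)
    then show ?thesis by (intro continuous_intros) auto
  qed
qed

lemma Re_power2_times_Ln:
  assumes "z \<noteq> 0"
  shows "Re (z\<^sup>2 * Ln z) = Re (z\<^sup>2) * ln (norm z) - Im (z\<^sup>2) * Arg z"
  using assms by (simp add: Arg_eq_Im_Ln)

lemma Re_power2_times_Ln_le:
  assumes "\<bar>Im z\<bar> \<le> Re z"
  shows "Re (z\<^sup>2 * Ln z) \<le> Re (z\<^sup>2) * ln (norm z)"
proof (cases "z = 0")
  case False
  then have "Re z > 0" using assms by (auto simp: complex_eq_iff)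
  then have "Arg z = arctan (Im z / Re z)" by (rule arg_conv_arctan)
  then have "Im z * Arg z \<ge> 0" using \<open>Re z > 0\<close>
    by (cases "Im z \<ge> 0") (auto simp: zero_le_mult_iff divide_nonpos_pos)
  moreover have "Im (z\<^sup>2) * Arg z = 2 * Re z * (Im z * Arg z)" by (simp add: Im_power2)
  ultimately have "Im (z\<^sup>2) * Arg z \<ge> 0"
    using \<open>Re z > 0\<close> by (metis less_imp_le mult_nonneg_nonneg zero_le_numeral)
  then show ?thesis using Re_power2_times_Ln[OF False] by simp
qed auto

text \<open>On the two edges the real part of z^2 vanishes. Only the angular term survives, with
  \<open>Arg z\<close> equal to pi/4 or -pi/4 and \<open>Im (z\<^sup>2)\<close> equal to |z|^2 with
  the same sign.\<close>

lemma Re_power2_times_Ln_diagonal: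
  assumes "\<bar>Im z\<bar> = Re z"
  shows "Re (z\<^sup>2 * Ln z) = - (pi / 4) * (norm z)\<^sup>2"
proof (cases "z = 0")
  case False
  then have pos: "Re z > 0" using assms by (auto simp: complex_eq_iff)
  then have A: "Arg z = arctan (Im z / Re z)" by (rule arg_conv_arctan)
  have "Im z = Re z \<or> Im z = - Re z" using assms by auto
  then show ?thesis
    unfolding Re_power2_times_Ln[OF False] A cmod_power2
    using pos by (auto simp: arctan_one arctan_minus Re_power2 Im_power2 power2_eq_square)
qed auto

section \<open>A quadratic bound from one pointwise second derivative\<close>

text \<open>As \<open>f'\<close> is only assumed differentiable at 0, there is no second-derivative
  remainder to use. Instead the Taylor remainder has derivative at most
  \<open>e * \<bar>h\<bar>\<close> near 0, and the mean value inequality on the interval from -|x|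
  to |x| yields the error \<open>e * x\<^sup>2\<close>.\<close>

lemma quadratic_Taylor_bound:
  fixes f f' :: "real \<Rightarrow> real"
  assumes "\<And>x. \<bar>x\<bar> < r \<Longrightarrow> (f has_real_derivative f' x) (at x)" "0 < r"
    and "(f' has_real_derivative A) (at 0)" "0 < e"
  shows "\<exists>d>0. \<forall>x. \<bar>x\<bar> < d \<longrightarrow> f x \<le> f 0 + f' 0 * x + (A / 2 + e) * x\<^sup>2"
proof -
  have "\<forall>\<^sub>F h in at 0. \<bar>(f' h - f' 0) / h - A\<bar> < e"
    using assms(3,4) tendstoD[of "\<lambda>h. (f' h - f' 0) / h" A "at 0" e]
    by (simp add: DERIV_def dist_real_def)
  then obtain d where d: "d > 0" "\<And>h. h \<noteq> 0 \<Longrightarrow> \<bar>h\<bar> < d \<Longrightarrow> \<bar>(f' h - f' 0) / h - A\<bar> < e"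
    by (auto simp: eventually_at)
  have der: "\<bar>f' h - f' 0 - A * h\<bar> \<le> e * \<bar>h\<bar>" if "\<bar>h\<bar> < d" for h
  proof (cases "h = 0")
    case False
    have "\<bar>f' h - f' 0 - A * h\<bar> = \<bar>(f' h - f' 0) / h - A\<bar> * \<bar>h\<bar>"
      using False by (simp add: abs_mult[symmetric] field_simps)
    then show ?thesis using d(2)[OF False that] by (simp add: mult_right_mono)
  qed auto
  define \<phi> where "\<phi> x = f x - f' 0 * x - A / 2 * x\<^sup>2" for x
  have "\<phi> x \<le> \<phi> 0 + e * x\<^sup>2" if x: "\<bar>x\<bar> < min d r" for x
  proof -
    have "norm (\<phi> x - \<phi> 0) \<le> (e * \<bar>x\<bar>) * norm (x - 0)"
    proof (rule field_differentiable_bound[where S="{-\<bar>x\<bar>..\<bar>x\<bar>}" and f'="\<lambda>h. f' h - f' 0 - A * h"])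
      fix h assume h: "h \<in> {-\<bar>x\<bar>..\<bar>x\<bar>}"
      then have "\<bar>h\<bar> < r" "\<bar>h\<bar> < d" "\<bar>h\<bar> \<le> \<bar>x\<bar>" using x by auto
      show "(\<phi> has_field_derivative f' h - f' 0 - A * h) (at h within {-\<bar>x\<bar>..\<bar>x\<bar>})"
        unfolding \<phi>_def
        by (rule DERIV_subset[of _ _ _ UNIV])
           (auto intro!: derivative_eq_intros assms(1) \<open>\<bar>h\<bar> < r\<close>)
      show "norm (f' h - f' 0 - A * h) \<le> e * \<bar>x\<bar>"
        using der[OF \<open>\<bar>h\<bar> < d\<close>] mult_left_mono[OF \<open>\<bar>h\<bar> \<le> \<bar>x\<bar>\<close>, of e] \<open>0 < e\<close>
        unfolding real_norm_def by linarith
    qed auto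
    then show ?thesis by (simp add: power2_eq_square mult.assoc abs_mult_self_eq)
  qed
  then show ?thesis using d(1) \<open>0 < r\<close>
    by (intro exI[of _ "min d r"]) (auto simp: \<phi>_def algebra_simps)
qed

section \<open>Subharmonic functions in the complex plane: maxima and comparison\<close>

text \<open>Complex arguments give direct access to holomorphic functions. The sub-mean value
  inequality is tested against continuous majorants of \<open>v\<close>, the form that
  \<open>circle_mean_le\<close> provides.\<close>

locale subharmonic_plane =
  fixes U :: "complex set" and v :: "complex \<Rightarrow> ereal"
  assumes open_U: "open U"
    and less_top: "z \<in> U \<Longrightarrow> v z < \<infinity>"
    and usc: "z \<in> U \<Longrightarrow> v z < c \<Longrightarrow> \<forall>\<^sub>F w in nhds z. v w < c"
    and submean: "0 < r \<Longrightarrow> cball z r \<subseteq> U \<Longrightarrow> continuous_on {0..2 * pi} H \<Longrightarrow>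
      (\<And>t. t \<in> {0..2 * pi} \<Longrightarrow> v (z + of_real r * cis t) \<le> ereal (H t)) \<Longrightarrow>
      v z \<le> ereal (integral {0..2 * pi} H / (2 * pi))"
begin

text \<open>A constant strictly between \<open>v z\<close> and \<open>H z\<close> separates the
  functions near \<open>z\<close>: upper semicontinuity keeps \<open>v\<close> below it, continuity
  keeps \<open>H\<close> above it.\<close>

lemma less_continuous_open_neighbourhood:
  assumes "z \<in> K" "K \<subseteq> U" "continuous_on K H" "v z < ereal (H z)"
  shows "\<exists>T. open T \<and> z \<in> T \<and> (\<forall>w\<in>T \<inter> K. v w < ereal (H w))"
proof -
  obtain c where c: "v z < c" "c < ereal (H z)" using dense[OF assms(4)] by blast
  have 1: "\<forall>\<^sub>F w in nhds z. v w < c" using usc c assms by blast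
  have "((\<lambda>w. ereal (H w)) \<longlongrightarrow> ereal (H z)) (at z within K)"
    using assms(1,3) by (auto simp: continuous_on_def)
  then have "\<forall>\<^sub>F w in at z within K. c < ereal (H w)" using c order_tendstoD(1) by blast
  then have 2: "\<forall>\<^sub>F w in nhds z. w \<in> K \<longrightarrow> c < ereal (H w)"
    using c by (auto simp: eventually_at_filter elim!: eventually_mono)
  have "\<forall>\<^sub>F w in nhds z. w \<in> K \<longrightarrow> v w < ereal (H w)"
    using 1 2 by eventually_elim auto
  then show ?thesis by (auto simp: eventually_nhds)
qed

text \<open>If every point were beaten by another, upper semicontinuity would let the same witness
  beat a whole neighbourhood. A finite subcover leaves finitely many witnesses, and the best of them
  would be beaten by one of the others.\<close>

lemma attains_max:
  assumes K: "compact K" "K \<subseteq> U" "z\<^sub>0 \<in> K" and H: "continuous_on K H"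
  shows "\<exists>p\<in>K. \<forall>q\<in>K. v q - ereal (H q) \<le> v p - ereal (H p)"
proof (rule ccontr)
  assume "\<not> ?thesis"
  then have "\<forall>p\<in>K. \<exists>q\<in>K. v p - ereal (H p) < v q - ereal (H q)" by (auto simp: not_le)
  have "\<forall>p\<in>K. \<exists>q\<in>K. \<exists>T. open T \<and> p \<in> T \<and> (\<forall>w\<in>T \<inter> K. v w - ereal (H w) < v q - ereal (H q))"
  proof
    fix p assume p: "p \<in> K"
    then obtain q where q: "q \<in> K" "v p - ereal (H p) < v q - ereal (H q)"
      using \<open>\<forall>p\<in>K. \<exists>q\<in>K. _\<close> by blast
    \<comment> \<open>\<open>v q\<close> is not minus infinity, since \<open>v q - H q\<close>
      strictly exceeds another extended value. The claim thus becomes a comparison of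
      \<open>v\<close> with a real continuous function.\<close>
    obtain m where m: "v q = ereal m"
      using q less_top[of q] K by (cases "v q") auto
    have "v p < ereal (H p + (m - H q))" using q m by (cases "v p") auto
    moreover have "continuous_on K (\<lambda>w. H w + (m - H q))" using H by (intro continuous_intros)
    ultimately obtain T where
      "open T" "p \<in> T" "\<forall>w\<in>T \<inter> K. v w < ereal (H w + (m - H q))"
      using less_continuous_open_neighbourhood[OF p K(2), of "\<lambda>w. H w + (m - H q)"] by blast
    moreover have "v w - ereal (H w) < v q - ereal (H q)" if "v w < ereal (H w + (m - H q))" for w
      using that m by (cases "v w") auto
    ultimately show "\<exists>q\<in>K. \<exists>T. open T \<and> p \<in> T \<and> (\<forall>w\<in>T \<inter> K. v w - ereal (H w) < v q - ereal (H q))"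
      using q(1) by blast
  qed
  then obtain q T where qT: "\<And>p. p \<in> K \<Longrightarrow> q p \<in> K" "\<And>p. p \<in> K \<Longrightarrow> open (T p)" "\<And>p. p \<in> K \<Longrightarrow> p \<in> T p"
    "\<And>p w. p \<in> K \<Longrightarrow> w \<in> T p \<inter> K \<Longrightarrow> v w - ereal (H w) < v (q p) - ereal (H (q p))"
    by metis
  obtain D where D: "D \<subseteq> K" "finite D" "K \<subseteq> (\<Union>p\<in>D. T p)"
    by (rule compactE_image[OF K(1), of K T]) (use qT in auto)
  define S where "S = (\<lambda>p. v (q p) - ereal (H (q p))) ` D"
  have S: "finite S" "S \<noteq> {}" using D K by (auto simp: S_def)
  from Max_in[OF this] obtain p where p: "p \<in> D" "Max S = v (q p) - ereal (H (q p))"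
    by (auto simp: S_def)
  then have "q p \<in> K" using D qT by auto
  then obtain p' where p': "p' \<in> D" "q p \<in> T p'" using D by auto
  then have "Max S < v (q p') - ereal (H (q p'))" using qT(4)[of p' "q p"] D \<open>q p \<in> K\<close> p by auto
  moreover have "v (q p') - ereal (H (q p')) \<le> Max S" using S p' by (intro Max_ge) (auto simp: S_def)
  ultimately show False by simp
qed

text \<open>The strictly superharmonic term \<open>- c |z|\<^sup>2\<close> makes an interior maximum impossible, so
  that connectedness plays no role.\<close>

lemma comparison:
  assumes K: "compact K" "K \<subseteq> U" and V: "open V" "V \<subseteq> K"
    and F: "continuous_on K F" "F holomorphic_on V" and "0 < c"
    and bd: "\<And>z. z \<in> K - V \<Longrightarrow> v z \<le> ereal (Re (F z) - c * (norm z)\<^sup>2)"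
    and "z \<in> K"
  shows "v z \<le> ereal (Re (F z) - c * (norm z)\<^sup>2)"
proof (rule ccontr)
  define H where "H z = Re (F z) - c * (norm z)\<^sup>2" for z
  assume "\<not> ?thesis"
  then have z: "ereal (H z) < v z" by (simp add: H_def not_le)
  have contH: "continuous_on K H" unfolding H_def by (intro continuous_intros F)
  obtain p where p: "p \<in> K" and max: "\<And>q. q \<in> K \<Longrightarrow> v q - ereal (H q) \<le> v p - ereal (H p)"
    using attains_max[OF K \<open>z \<in> K\<close> contH] by blast
  have "0 < v z - ereal (H z)" using z by (cases "v z") auto
  then have pos: "0 < v p - ereal (H p)" using max[OF \<open>z \<in> K\<close>] by simp
  obtain a where a: "v p = ereal a" using pos less_top[of p] p K by (cases "v p") auto
  have "\<not> v p \<le> ereal (H p)" using pos a by auto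
  then have "p \<in> V" using bd[of p] p by (auto simp: H_def)
  then obtain R where R: "R > 0" "ball p R \<subseteq> V"
    using open_contains_ball[of V] V(1) by auto
  define r where "r = R / 2"
  have r: "0 < r" "r < R" "cball p r \<subseteq> ball p R" using R by (auto simp: r_def)
  have rK: "cball p r \<subseteq> K" using r R V(2) by blast
  have circ: "p + of_real r * cis t \<in> cball p r" for t using r(1) by (simp add: dist_norm norm_mult)
  \<comment> \<open>On the circle of radius \<open>r\<close> about \<open>p\<close>, |z|^2 = |p|^2 +
    r^2 + 2 Re (cnj p * (z - p)). Hence \<open>H + (a - H p)\<close> coincides there with the
    harmonic function \<open>Re (G z) + k\<close>, whose mean is explicit.\<close>
  define G where "G z = F z - 2 * of_real c * cnj p * (z - p)" for z
  define k where "k = a - H p - c * ((norm p)\<^sup>2 + r\<^sup>2)"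
  have HG: "H (p + of_real r * cis t) + (a - H p) = Re (G (p + of_real r * cis t)) + k" for t
  proof -
    have "r * (r * (cos t * cos t)) + r * (r * (sin t * sin t)) = r * r"
      using sin_cos_squared_add3[of t] by (simp flip: distrib_left)
    then have "(norm (p + of_real r * cis t))\<^sup>2 = (norm p)\<^sup>2 + r\<^sup>2 + 2 * Re (cnj p * (of_real r * cis t))"
      unfolding cmod_power2 by (simp add: power2_eq_square algebra_simps)
    then show ?thesis by (simp add: H_def G_def k_def algebra_simps)
  qed
  have "G holomorphic_on ball p R" unfolding G_def
    by (intro holomorphic_intros holomorphic_on_subset[OF F(2) R(2)])
  from holomorphic_mean_value[OF this r(1,2)]
  have "((\<lambda>t. Re (G (p + of_real r * cis t))) has_integral 2 * pi * Re (F p)) {0..2 * pi}"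
    by (simp add: G_def)
  from has_integral_add[OF this has_integral_const_real[of k 0 "2 * pi"]]
  have int: "integral {0..2 * pi} (\<lambda>t. Re (G (p + of_real r * cis t)) + k) = 2 * pi * (Re (F p) + k)"
    by (intro integral_unique) (simp add: algebra_simps)
  have "v p \<le> ereal (integral {0..2 * pi} (\<lambda>t. Re (G (p + of_real r * cis t)) + k) / (2 * pi))"
  proof (rule submean[OF r(1)])
    show "cball p r \<subseteq> U" using rK K by auto
    have "continuous_on K G" unfolding G_def by (intro continuous_intros F)
    moreover have "continuous_on {0..2 * pi} (\<lambda>t. p + of_real r * cis t)" by (intro continuous_intros)
    ultimately have "continuous_on {0..2 * pi} (\<lambda>t. G (p + of_real r * cis t))"
      by (rule continuous_on_compose2) (use rK circ in blast)
    then show "continuous_on {0..2 * pi} (\<lambda>t. Re (G (p + of_real r * cis t)) + k)"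
      by (intro continuous_intros)
    \<comment> \<open>Maximality of \<open>v - H\<close> at \<open>p\<close> makes the shifted
      \<open>H\<close> a majorant of \<open>v\<close> that touches it at \<open>p\<close>.\<close>
    have "v q \<le> ereal (H q + (a - H p))" if "q \<in> K" for q
      using max[OF that] a by (cases "v q") auto
    then show "v (p + of_real r * cis t) \<le> ereal (Re (G (p + of_real r * cis t)) + k)" for t
      using rK circ[of t] unfolding HG[symmetric] by blast
  qed
  then have "a \<le> Re (F p) + k" unfolding int a by simp
  \<comment> \<open>The mean of -c |z|^2 over the circle lies c r^2 below its value at
    \<open>p\<close>; this loss is the contradiction.\<close>
  also have "\<dots> = a - c * r\<^sup>2" by (simp add: k_def H_def algebra_simps)
  finally show False using \<open>0 < c\<close> r(1) by (simp add: mult_le_0_iff)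
qed

section \<open>Spreading the bound from the edges of a sector to its interior\<close>

text \<open>Of the \<open>3 * c\<close> on the edges, one \<open>c\<close> pays for the logarithmic
  term, one remains as the superharmonic term for \<open>comparison\<close>, and one is slack that
  makes the edge inequality strict away from 0.\<close>

lemma sector_bound:
  assumes "norm \<omega> = 1" "0 < R" "cball 0 R \<subseteq> U" and g: "g holomorphic_on UNIV" and "0 < c"
    and bd: "\<And>z. \<bar>Im z\<bar> = Re z \<Longrightarrow> norm z \<le> R \<Longrightarrow> v (\<omega> * z) \<le> ereal (Re (g (\<omega> * z)) - 3 * c * (norm z)\<^sup>2)"
  shows "\<exists>\<rho>>0. \<forall>z. \<bar>Im z\<bar> \<le> Re z \<longrightarrow> norm z \<le> \<rho> \<longrightarrow> v (\<omega> * z) \<le> ereal (Re (g (\<omega> * z)) - c * (norm z)\<^sup>2)"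
proof -
  \<comment> \<open>Multiplication by \<open>\<sigma>\<close> undoes the rotation by
    \<open>\<omega>\<close>, so that the logarithm of \<open>\<sigma> * w\<close> stays away from
    its branch cut on the open sector.\<close>
  define \<sigma> where "\<sigma> = cnj \<omega>"
  have \<sigma>: "\<omega> * (\<sigma> * w) = w" "\<sigma> * (\<omega> * w) = w" "norm (\<sigma> * w) = norm w" for w
    using \<open>norm \<omega> = 1\<close> complex_norm_square[of \<omega>] by (auto simp: \<sigma>_def norm_mult mult.assoc[symmetric] mult.commute)
  define K where "K = {w. \<bar>Im (\<sigma> * w)\<bar> \<le> Re (\<sigma> * w)} \<inter> cball 0 R"
  define V where "V = {w. \<bar>Im (\<sigma> * w)\<bar> < Re (\<sigma> * w)} \<inter> ball 0 R"
  have K: "compact K" "K \<subseteq> U" using assms(3) unfolding K_def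
    by (auto intro!: closed_Int_compact closed_Collect_le continuous_intros)
  have V: "open V" "V \<subseteq> K" unfolding V_def K_def
    by (auto intro!: open_Int open_Collect_less continuous_intros)
  have Kpos: "Re (\<sigma> * w) > 0 \<or> \<sigma> * w = 0" if "w \<in> K" for w
    using that by (auto simp: K_def complex_eq_iff)
  \<comment> \<open>By \<open>Re_power2_times_Ln_diagonal\<close> the factor
    \<open>4 * c / pi\<close> turns the logarithmic term into -c |w|^2 on the edges. The real part
    of the \<open>k\<close> term vanishes there, so \<open>k\<close> stays free for the arc.\<close>
  define F where "F k w = g w + of_real (4 * c / pi) * ((\<sigma> * w)\<^sup>2 * Ln (\<sigma> * w)) + of_real k * (\<sigma> * w)\<^sup>2" for k w
  define H where "H k w = Re (F k w) - c * (norm w)\<^sup>2" for k w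
  have gc: "continuous_on A g" for A
    using holomorphic_on_imp_continuous_on[OF g] continuous_on_subset by blast
  have "continuous_on K (\<lambda>w. (\<sigma> * w)\<^sup>2 * Ln (\<sigma> * w))"
    by (rule continuous_on_compose2[OF continuous_on_power2_times_Ln]) (intro continuous_intros, use Kpos in blast)
  then have Fc: "continuous_on K (F k)" for k unfolding F_def
    by (intro continuous_on_add gc continuous_on_mult_left continuous_on_power continuous_on_id)
  have Fh: "F k holomorphic_on V" for k
  proof -
    have "\<sigma> * w \<notin> \<real>\<^sub>\<le>\<^sub>0" if "w \<in> V" for w
      using that by (auto simp: V_def complex_nonpos_Reals_iff)
    then show ?thesis unfolding F_def
      by (intro holomorphic_intros holomorphic_on_subset[OF g]) auto
  qed
  have Hc: "continuous_on K (H k)" for k unfolding H_def by (intro continuous_intros Fc)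
  \<comment> \<open>The slack c |w|^2 vanishes at the apex, where only the weak inequality is
    left.\<close>
  have edge: "v w < ereal (H k w) \<or> w = 0 \<and> v w \<le> ereal (H k w)"
    if "\<bar>Im (\<sigma> * w)\<bar> = Re (\<sigma> * w)" "norm w \<le> R" for w k
  proof -
    have "Re ((\<sigma> * w)\<^sup>2) = 0" using that(1)
      by (metis Re_power2 diff_self power2_abs)
    then have "H k w = Re (g w) + 4 * c / pi * Re ((\<sigma> * w)\<^sup>2 * Ln (\<sigma> * w)) - c * (norm w)\<^sup>2"
      by (simp add: H_def F_def)
    also have "\<dots> = Re (g w) - 2 * c * (norm w)\<^sup>2"
      unfolding Re_power2_times_Ln_diagonal[OF that(1)] by (simp add: \<sigma>)
    finally have Hw: "H k w = Re (g w) - 2 * c * (norm w)\<^sup>2" .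
    have vw: "v w \<le> ereal (Re (g w) - 3 * c * (norm w)\<^sup>2)" using bd[of "\<sigma> * w"] that by (simp add: \<sigma>)
    show ?thesis
    proof (cases "w = 0")
      case False
      then have "c * (norm w)\<^sup>2 > 0" using \<open>0 < c\<close> by simp
      then have "ereal (Re (g w) - 3 * c * (norm w)\<^sup>2) < ereal (H k w)" unfolding Hw by simp
      with vw show ?thesis by (blast intro: order_le_less_trans)
    qed (use vw Hw in auto)
  qed
  \<comment> \<open>The real part of the square is nonnegative in the sector, so a larger
    \<open>k\<close> only raises \<open>H\<close>. This merges finitely many local choices of
    \<open>k\<close> into one.\<close>
  have Hmono: "H k w \<le> H k' w" if "k \<le> k'" "w \<in> K" for k k' w
  proof -
    have "(Im (\<sigma> * w))\<^sup>2 \<le> (Re (\<sigma> * w))\<^sup>2" using that(2) by (intro abs_le_square_iff[THEN iffD1]) (auto simp: K_def)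
    then have "k * Re ((\<sigma> * w)\<^sup>2) \<le> k' * Re ((\<sigma> * w)\<^sup>2)" using that(1) by (intro mult_right_mono) (auto simp: Re_power2)
    then show ?thesis by (simp add: H_def F_def)
  qed
  \<comment> \<open>At the two corners of the arc \<open>Re ((\<sigma> * w)\<^sup>2)\<close> vanishes, and the gap between \<open>3 * c\<close> and
    \<open>2 * c\<close> on the edges has to be spread by upper semicontinuity.\<close>
  define A where "A = K \<inter> sphere 0 R"
  have "\<forall>w\<in>A. \<exists>k T. open T \<and> w \<in> T \<and> (\<forall>w'\<in>T \<inter> K. v w' < ereal (H k w'))"
  proof
    fix w assume w: "w \<in> A"
    then have wK: "w \<in> K" "norm w = R" by (auto simp: A_def)
    have "\<exists>k. v w < ereal (H k w)"
    proof (cases "\<bar>Im (\<sigma> * w)\<bar> = Re (\<sigma> * w)")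
      case True
      then show ?thesis using edge[of w] wK \<open>0 < R\<close> by auto
    next
      case False
      then have "\<bar>Im (\<sigma> * w)\<bar> < \<bar>Re (\<sigma> * w)\<bar>" using wK by (auto simp: K_def)
      then have "(Im (\<sigma> * w))\<^sup>2 < (Re (\<sigma> * w))\<^sup>2" by (metis abs_ge_zero power2_abs power_strict_mono zero_less_numeral)
      then have pos: "Re ((\<sigma> * w)\<^sup>2) > 0" by (simp add: Re_power2)
      have Hk: "H k w = H 0 w + k * Re ((\<sigma> * w)\<^sup>2)" for k by (simp add: H_def F_def)
      show ?thesis
      proof (cases "v w")
        case (real a)
        \<comment> \<open>The value of \<open>k\<close> is solved from \<open>H k w = a + 1\<close>,
          using that \<open>H\<close> is affine in \<open>k\<close> with positive slope
          here.\<close>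
        have "H ((a - H 0 w + 1) / Re ((\<sigma> * w)\<^sup>2)) w = a + 1"
          using pos by (subst Hk) simp
        then have "v w < ereal (H ((a - H 0 w + 1) / Re ((\<sigma> * w)\<^sup>2)) w)" using real by simp
        then show ?thesis by blast
      qed (use less_top[of w] wK K in auto)
    qed
    then obtain k where "v w < ereal (H k w)" by blast
    from less_continuous_open_neighbourhood[OF wK(1) K(2) Hc this]
    show "\<exists>k T. open T \<and> w \<in> T \<and> (\<forall>w'\<in>T \<inter> K. v w' < ereal (H k w'))" by blast
  qed
  then obtain k T where kT: "\<And>w. w \<in> A \<Longrightarrow> open (T w)" "\<And>w. w \<in> A \<Longrightarrow> w \<in> T w"
    "\<And>w w'. w \<in> A \<Longrightarrow> w' \<in> T w \<inter> K \<Longrightarrow> v w' < ereal (H (k w) w')"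
    by metis
  have "compact A" unfolding A_def using K by (intro compact_Int_closed) auto
  then obtain D where D: "D \<subseteq> A" "finite D" "A \<subseteq> (\<Union>w\<in>D. T w)"
    by (rule compactE_image[of A A T]) (use kT in auto)
  \<comment> \<open>The extra 0 guards \<open>Max\<close> against an empty subcover.\<close>
  define m where "m = Max (insert 0 (k ` D))"
  have arc: "v w \<le> ereal (H m w)" if w: "w \<in> A" for w
  proof -
    obtain p where p: "p \<in> D" "w \<in> T p" using D w by auto
    have "w \<in> K" using w by (simp add: A_def)
    then have "v w < ereal (H (k p) w)" using kT(3)[of p w] D(1) p by blast
    moreover have "k p \<le> m" using p D unfolding m_def by (intro Max_ge) auto
    then have "ereal (H (k p) w) \<le> ereal (H m w)" using Hmono \<open>w \<in> K\<close> by simp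
    ultimately show ?thesis by (rule order_trans[OF less_imp_le])
  qed
  have main: "v w \<le> ereal (H m w)" if "w \<in> K" for w
    unfolding H_def
  proof (rule comparison[OF K V Fc Fh \<open>0 < c\<close> _ that])
    fix w assume w: "w \<in> K - V"
    then have "w \<in> A \<or> \<bar>Im (\<sigma> * w)\<bar> = Re (\<sigma> * w) \<and> norm w \<le> R" by (auto simp: A_def K_def V_def)
    then show "v w \<le> ereal (Re (F m w) - c * (norm w)\<^sup>2)"
      using arc[of w] edge[of w m] by (auto simp: H_def)
  qed
  \<comment> \<open>For 0 < |z| <= \<rho> this gives
    \<open>4 * c / pi * ln (norm z) + m \<le> 0\<close>: the logarithm absorbs the constant spent on
    the arc.\<close>
  define \<rho> where "\<rho> = min R (exp (- m * pi / (4 * c)))"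
  show ?thesis
  proof (intro exI[of _ \<rho>] conjI allI impI)
    show "\<rho> > 0" using \<open>0 < R\<close> by (simp add: \<rho>_def)
    fix z assume z: "\<bar>Im z\<bar> \<le> Re z" "norm z \<le> \<rho>"
    have nz: "norm (\<omega> * z) = norm z" using \<open>norm \<omega> = 1\<close> by (simp add: norm_mult)
    have "\<omega> * z \<in> K" using z nz unfolding K_def \<rho>_def by (simp add: \<sigma> del: times_complex.sel)
    from main[OF this] have "v (\<omega> * z) \<le> ereal (H m (\<omega> * z))" .
    also have "H m (\<omega> * z) \<le> Re (g (\<omega> * z)) - c * (norm z)\<^sup>2"
    proof (cases "z = 0")
      case False
      then have "ln (norm z) \<le> ln (exp (- m * pi / (4 * c)))"
        using z by (subst ln_le_cancel_iff) (auto simp: \<rho>_def)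
      then have "4 * c / pi * ln (norm z) + m \<le> 0" using \<open>0 < c\<close> by (simp add: field_simps)
      moreover have "(Im z)\<^sup>2 \<le> (Re z)\<^sup>2" using z by (intro abs_le_square_iff[THEN iffD1]) auto
      ultimately have "Re (z\<^sup>2) * (4 * c / pi * ln (norm z) + m) \<le> 0"
        by (intro mult_nonneg_nonpos) (auto simp: Re_power2)
      moreover have "4 * c / pi * Re (z\<^sup>2 * Ln z) \<le> 4 * c / pi * (Re (z\<^sup>2) * ln (norm z))"
        using Re_power2_times_Ln_le[OF z(1)] \<open>0 < c\<close> by (intro mult_left_mono) auto
      ultimately have "4 * c / pi * Re (z\<^sup>2 * Ln z) + m * Re (z\<^sup>2) \<le> 0"
        by (simp add: algebra_simps)
      moreover have "H m (\<omega> * z) = Re (g (\<omega> * z)) + (4 * c / pi * Re (z\<^sup>2 * Ln z) + m * Re (z\<^sup>2)) - c * (norm z)\<^sup>2"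
        unfolding H_def F_def \<sigma> nz by (simp add: Re_divide_of_real)
      ultimately show ?thesis by simp
    qed (simp add: H_def F_def)
    finally show "v (\<omega> * z) \<le> ereal (Re (g (\<omega> * z)) - c * (norm z)\<^sup>2)" by simp
  qed
qed

section \<open>From the axes to a full circle\<close>

text \<open>At 0 the hypothesis gives only a weak inequality. Four uses of
  \<open>sector_bound\<close> carry the quadratic gap to a whole small circle, and the sub-mean
  value inequality there gains c r^2 at the centre.\<close>

lemma not_below_harmonic_on_axes:
  assumes "0 < R" "cball 0 R \<subseteq> U" and g: "g holomorphic_on UNIV" and "0 < c"
    and bd: "\<And>z. Re z = 0 \<or> Im z = 0 \<Longrightarrow> norm z \<le> R \<Longrightarrow> v z \<le> ereal (Re (g z) - 3 * c * (norm z)\<^sup>2)"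
  shows "v 0 < ereal (Re (g 0))"
proof -
  \<comment> \<open>For signs \<open>s\<close> and \<open>t\<close> these are the unit vectors
    bisecting the quadrants; multiplication by them carries the edges of the sector to the
    axes.\<close>
  define \<omega> where "\<omega> s t = Complex (s / sqrt 2) (t / sqrt 2)" for s t
  have n\<omega>: "norm (\<omega> s t) = 1" if "\<bar>s\<bar> = 1" "\<bar>t\<bar> = 1" for s t
  proof -
    have "s\<^sup>2 = 1" "t\<^sup>2 = 1" using that by (metis one_power2 power2_abs)+
    then show ?thesis by (simp add: \<omega>_def cmod_def power_divide)
  qed
  have "\<exists>\<rho>>0. \<forall>z. \<bar>Im z\<bar> \<le> Re z \<longrightarrow> norm z \<le> \<rho> \<longrightarrow> v (\<omega> s t * z) \<le> ereal (Re (g (\<omega> s t * z)) - c * (norm z)\<^sup>2)"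
    if st: "\<bar>s\<bar> = 1" "\<bar>t\<bar> = 1" for s t
  proof (rule sector_bound[OF n\<omega>[OF st] assms(1-4)])
    fix z assume z: "\<bar>Im z\<bar> = Re z" "norm z \<le> R"
    have "Re (\<omega> s t * z) = 0 \<or> Im (\<omega> s t * z) = 0"
      using st z(1) by (auto simp: \<omega>_def abs_if field_simps split: if_splits)
    then show "v (\<omega> s t * z) \<le> ereal (Re (g (\<omega> s t * z)) - 3 * c * (norm z)\<^sup>2)"
      using bd[of "\<omega> s t * z"] z n\<omega>[OF st] by (simp add: norm_mult)
  qed
  then obtain \<rho> where \<rho>: "\<And>s t. \<bar>s\<bar> = 1 \<Longrightarrow> \<bar>t\<bar> = 1 \<Longrightarrow> \<rho> s t > (0::real)"
    "\<And>s t z. \<bar>s\<bar> = 1 \<Longrightarrow> \<bar>t\<bar> = 1 \<Longrightarrow> \<bar>Im z\<bar> \<le> Re z \<Longrightarrow> norm z \<le> \<rho> s t \<Longrightarrow>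
       v (\<omega> s t * z) \<le> ereal (Re (g (\<omega> s t * z)) - c * (norm z)\<^sup>2)"
    by metis
  define r where "r = Min {R, \<rho> 1 1, \<rho> 1 (-1), \<rho> (-1) 1, \<rho> (-1) (-1)}"
  have r: "0 < r" "r \<le> R" "\<And>s t. \<bar>s\<bar> = 1 \<Longrightarrow> \<bar>t\<bar> = 1 \<Longrightarrow> r \<le> \<rho> s t"
    using \<rho>(1) \<open>0 < R\<close> by (auto simp: r_def abs_if split: if_splits)
  have le: "v z \<le> ereal (Re (g z) - c * r\<^sup>2)" if z: "norm z = r" for z
  proof -
    \<comment> \<open>The signs select a closed quadrant containing \<open>z\<close>.\<close>
    define s t :: real where "s = (if Re z \<ge> 0 then 1 else -1)" and "t = (if Im z \<ge> 0 then 1 else -1)"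
    have st: "\<bar>s\<bar> = 1" "\<bar>t\<bar> = 1" by (auto simp: s_def t_def)
    define z' where "z' = cnj (\<omega> s t) * z"
    have "\<omega> s t * z' = z" using n\<omega>[OF st] complex_norm_square[of "\<omega> s t"]
      by (simp add: z'_def mult.assoc[symmetric])
    moreover have "norm z' = r" using n\<omega>[OF st] z by (simp add: z'_def norm_mult)
    moreover have "\<bar>Im z'\<bar> \<le> Re z'"
    proof -
      have "Re z' = (s * Re z + t * Im z) / sqrt 2" "Im z' = (s * Im z - t * Re z) / sqrt 2"
        by (simp_all add: z'_def \<omega>_def add_divide_distrib diff_divide_distrib)
      moreover have "\<bar>s * Im z - t * Re z\<bar> \<le> s * Re z + t * Im z"
        by (auto simp: s_def t_def abs_if)
      ultimately show ?thesis by (simp add: abs_divide divide_right_mono)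
    qed
    ultimately show ?thesis using \<rho>(2)[OF st, of z'] r(3)[OF st] by simp
  qed
  have hol: "g holomorphic_on ball 0 (2 * r)" using g holomorphic_on_subset by blast
  have "((\<lambda>t. Re (g (of_real r * cis t))) has_integral 2 * pi * Re (g 0)) {0..2 * pi}"
    using holomorphic_mean_value[OF hol r(1)] r(1) by simp
  from has_integral_diff[OF this has_integral_const_real[of "c * r\<^sup>2" 0 "2 * pi"]]
  have int: "integral {0..2 * pi} (\<lambda>t. Re (g (of_real r * cis t)) - c * r\<^sup>2) = 2 * pi * (Re (g 0) - c * r\<^sup>2)"
    by (intro integral_unique) (simp add: algebra_simps)
  have "v 0 \<le> ereal (integral {0..2 * pi} (\<lambda>t. Re (g (of_real r * cis t)) - c * r\<^sup>2) / (2 * pi))"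
  proof (rule submean[OF r(1)])
    show "cball 0 r \<subseteq> U" using r(2) assms(2) by auto
    have "continuous_on {0..2 * pi} (\<lambda>t. of_real r * cis t)" by (intro continuous_intros)
    from continuous_on_compose2[OF holomorphic_on_imp_continuous_on[OF g] this]
    show "continuous_on {0..2 * pi} (\<lambda>t. Re (g (of_real r * cis t)) - c * r\<^sup>2)"
      by (intro continuous_intros) simp
    show "v (0 + of_real r * cis t) \<le> ereal (Re (g (of_real r * cis t)) - c * r\<^sup>2)" for t
      using le[of "of_real r * cis t"] r(1) by (simp add: norm_mult)
  qed
  also have "\<dots> < ereal (Re (g 0))" unfolding int using \<open>0 < c\<close> r(1) by simp
  finally show ?thesis .
qed

end

section \<open>Transfer to the complex plane and conclusion\<close>

text \<open>Identifying complex numbers with pairs is an isometry, so discs and circles correspond;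
  \<open>circle_mean_le\<close> supplies the majorant form of the mean value inequality.\<close>

lemma subharmonic_plane_of_subharmonic_on:
  assumes "open \<Omega>" and "subharmonic_on \<Omega> u"
  shows "subharmonic_plane {z. (Re z, Im z) \<in> \<Omega>} (\<lambda>z. u (Re z, Im z))"
proof
  have cont: "isCont (\<lambda>z. (Re z, Im z)) z" for z
    by (intro continuous_intros isCont_Re isCont_Im continuous_ident)
  have "open ((\<lambda>z. (Re z, Im z)) -` \<Omega>)"
    by (intro open_vimage \<open>open \<Omega>\<close> continuous_intros)
  then show "open {z. (Re z, Im z) \<in> \<Omega>}" by (simp add: vimage_def)
  show "u (Re z, Im z) < \<infinity>" if "z \<in> {z. (Re z, Im z) \<in> \<Omega>}" for z
    using that assms(2) by (auto simp: subharmonic_on_def)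
  show "\<forall>\<^sub>F w in nhds z. u (Re w, Im w) < a"
    if "z \<in> {z. (Re z, Im z) \<in> \<Omega>}" "u (Re z, Im z) < a" for z a
  proof -
    have "\<forall>\<^sub>F q in at (Re z, Im z). u q < a"
      using that assms by (auto simp: subharmonic_on_def usc_on_def at_within_open[of _ \<Omega>])
    \<comment> \<open>The punctured neighbourhoods of \<open>usc_on\<close> become full ones because
      the strict inequality also holds at the centre.\<close>
    then have "\<forall>\<^sub>F q in nhds (Re z, Im z). u q < a"
      using that by (auto simp: eventually_at_filter elim!: eventually_mono)
    moreover have "filterlim (\<lambda>w. (Re w, Im w)) (nhds (Re z, Im z)) (nhds z)"
      using cont[of z] unfolding isCont_def
      by (rule tendsto_at_iff_tendsto_nhds[of "\<lambda>w. (Re w, Im w)" z, THEN iffD1])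
    ultimately show ?thesis by (rule eventually_compose_filterlim)
  qed
  show "u (Re z, Im z) \<le> ereal (integral {0..2 * pi} H / (2 * pi))"
    if r: "0 < r" and sub: "cball z r \<subseteq> {z. (Re z, Im z) \<in> \<Omega>}" and H: "continuous_on {0..2 * pi} H"
      and le: "\<And>t. t \<in> {0..2 * pi} \<Longrightarrow> u (Re (z + of_real r * cis t), Im (z + of_real r * cis t)) \<le> ereal (H t)"
    for z r H
  proof -
    have "cball (Re z, Im z) r \<subseteq> \<Omega>"
    proof
      fix q assume q: "q \<in> cball (Re z, Im z) r"
      then have "Complex (fst q) (snd q) \<in> cball z r"
        by (auto simp: dist_prod_def dist_norm cmod_def dist_real_def)
      then show "q \<in> \<Omega>" using sub by auto
    qed
    then have "u (Re z, Im z) \<le> circle_mean u (Re z, Im z) r"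
      using assms(2) r by (auto simp: subharmonic_on_def)
    also have "\<dots> \<le> ereal (integral {0..2 * pi} H / (2 * pi))"
      by (rule circle_mean_le[OF H]) (use le in simp)
    finally show ?thesis .
  qed
qed

text \<open>Finiteness of \<open>f\<close> at each point near 0 lets the real estimate be read back
  for \<open>f\<close> itself, free of the default value of \<open>real_of_ereal\<close>.\<close>

lemma has_finite_derivative_quadratic_bound:
  assumes "\<And>x. \<bar>x\<bar> < r \<Longrightarrow> has_finite_derivative f (f' x) x" "0 < r"
    and "(f' has_real_derivative A) (at 0)" "0 < e"
  shows "\<exists>d>0. \<forall>x. \<bar>x\<bar> < d \<longrightarrow> f x \<le> ereal (real_of_ereal (f 0) + f' 0 * x + (A / 2 + e) * x\<^sup>2)"
proof -
  have fin: "\<bar>f x\<bar> \<noteq> \<infinity>" if "\<bar>x\<bar> < r" for x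
    using assms(1)[OF that] unfolding has_finite_derivative_def
    by (auto dest: eventually_nhds_x_imp_x)
  obtain d where d: "d > 0" "\<And>x. \<bar>x\<bar> < d \<Longrightarrow>
      real_of_ereal (f x) \<le> real_of_ereal (f 0) + f' 0 * x + (A / 2 + e) * x\<^sup>2"
    using quadratic_Taylor_bound[of r "\<lambda>x. real_of_ereal (f x)" f' A e] assms
    unfolding has_finite_derivative_def by blast
  have "f x \<le> ereal (real_of_ereal (f 0) + f' 0 * x + (A / 2 + e) * x\<^sup>2)" if "\<bar>x\<bar> < min d r" for x
    using d(2)[of x] fin[of x] that by (cases "f x") auto
  then show ?thesis using d(1) \<open>0 < r\<close> by (intro exI[of _ "min d r"]) auto
qed

theorem mainTheorem1:
  fixes \<Omega> :: "(real \<times> real) set"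
    and u :: "real \<times> real \<Rightarrow> ereal"
    and ux uy :: "real \<times> real \<Rightarrow> real"
    and uxx uyy :: real
  assumes "open \<Omega>"
    and "(0, 0) \<in> \<Omega>"
    and "subharmonic_on \<Omega> u"
    and "\<And>x y. (x, y) \<in> \<Omega> \<Longrightarrow> y = 0 \<or> x = 0 \<Longrightarrow> has_partial_x u (ux (x, y)) (x, y)"
    and "\<And>x y. (x, y) \<in> \<Omega> \<Longrightarrow> y = 0 \<or> x = 0 \<Longrightarrow> has_partial_y u (uy (x, y)) (x, y)"
    and "((\<lambda>x. ux (x, 0)) has_real_derivative uxx) (at 0)"
    and "((\<lambda>y. uy (0, y)) has_real_derivative uyy) (at 0)"
  shows "uxx + uyy \<ge> 0"
proof (rule ccontr)
  assume neg: "\<not> ?thesis"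
  \<comment> \<open>This choice solves (uxx + uyy) / 4 + 4 c = 0: one \<open>c\<close> is the Taylor
    error, the other three are the gap required by
    \<open>not_below_harmonic_on_axes\<close>.\<close>
  define c where "c = - (uxx + uyy) / 16"
  have "c > 0" using neg by (simp add: c_def)
  define U where "U = {z. (Re z, Im z) \<in> \<Omega>}"
  define v where "v z = u (Re z, Im z)" for z
  interpret subharmonic_plane U v
    unfolding U_def v_def by (rule subharmonic_plane_of_subharmonic_on[OF assms(1,3)])
  have "0 \<in> U" using assms(2) by (simp add: U_def)
  then obtain R where R: "R > 0" "ball 0 R \<subseteq> U" using open_U open_contains_ball by blast
  have "has_finite_derivative (\<lambda>s. u (s, 0)) (ux (x, 0)) x" if "\<bar>x\<bar> < R" for x
  proof -
    have "of_real x \<in> U" using R that by (intro subsetD[OF R(2)]) simp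
    then show ?thesis using assms(4)[of x 0] by (simp add: U_def has_partial_x_def)
  qed
  from has_finite_derivative_quadratic_bound[OF this R(1) assms(6) \<open>c > 0\<close>]
  obtain dx where dx: "dx > 0" "\<And>x. \<bar>x\<bar> < dx \<Longrightarrow>
      u (x, 0) \<le> ereal (real_of_ereal (u (0, 0)) + ux (0, 0) * x + (uxx / 2 + c) * x\<^sup>2)" by blast
  have "has_finite_derivative (\<lambda>s. u (0, s)) (uy (0, y)) y" if "\<bar>y\<bar> < R" for y
  proof -
    have "\<i> * of_real y \<in> U" using R that by (intro subsetD[OF R(2)]) (simp add: norm_mult)
    then show ?thesis using assms(5)[of 0 y] by (simp add: U_def has_partial_y_def)
  qed
  from has_finite_derivative_quadratic_bound[OF this R(1) assms(7) \<open>c > 0\<close>]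
  obtain dy where dy: "dy > 0" "\<And>y. \<bar>y\<bar> < dy \<Longrightarrow>
      u (0, y) \<le> ereal (real_of_ereal (u (0, 0)) + uy (0, 0) * y + (uyy / 2 + c) * y\<^sup>2)" by blast
  \<comment> \<open>\<open>Re (g z)\<close> is the Taylor polynomial of \<open>u\<close> on both axes plus \<open>4 * c * |z|\<^sup>2\<close>.\<close>
  define g where "g z = of_real (real_of_ereal (u (0, 0))) + Complex (ux (0, 0)) (- uy (0, 0)) * z
    + of_real ((uxx - uyy) / 4) * z\<^sup>2" for z
  \<comment> \<open>Halving makes the closed disc fit into the open ball and the open intervals of
    the Taylor bounds.\<close>
  define r where "r = Min {R, dx, dy} / 2"
  have r: "0 < r" "r < R" "r < dx" "r < dy" using R dx dy by (auto simp: r_def)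
  have "v 0 < ereal (Re (g 0))"
  proof (rule not_below_harmonic_on_axes[OF r(1) _ _ \<open>c > 0\<close>])
    show "cball 0 r \<subseteq> U" using R r by auto
    show "g holomorphic_on UNIV" unfolding g_def by (intro holomorphic_intros)
    fix z assume z: "Re z = 0 \<or> Im z = 0" "norm z \<le> r"
    have c: "(uxx - uyy) / 4 - 3 * c = uxx / 2 + c" "- (uxx - uyy) / 4 - 3 * c = uyy / 2 + c"
      by (simp_all add: c_def field_simps)
    from z(1) show "v z \<le> ereal (Re (g z) - 3 * c * (norm z)\<^sup>2)"
    proof
      assume "Im z = 0"
      then obtain x where x: "z = of_real x" by (metis complex_is_Real_iff Reals_cases)
      then have "Re (g z) - 3 * c * (norm z)\<^sup>2 =
          real_of_ereal (u (0, 0)) + ux (0, 0) * x + ((uxx - uyy) / 4 - 3 * c) * x\<^sup>2"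
        by (simp add: g_def Re_power2 left_diff_distrib)
      then show ?thesis using dx(2)[of x] x z(2) r unfolding c by (simp add: v_def)
    next
      assume "Re z = 0"
      then obtain y where y: "z = \<i> * of_real y" using complex_eq[of z] by (metis add_0 of_real_0)
      then have "Re (g z) - 3 * c * (norm z)\<^sup>2 =
          real_of_ereal (u (0, 0)) + uy (0, 0) * y + (- (uxx - uyy) / 4 - 3 * c) * y\<^sup>2"
        by (simp add: g_def Re_power2 norm_mult left_diff_distrib)
      then show ?thesis using dy(2)[of y] y z(2) r unfolding c by (simp add: v_def norm_mult)
    qed
  qed
  \<comment> \<open>Finiteness is essential: \<open>Re (g 0)\<close> is
    \<open>real_of_ereal (u (0, 0))\<close>, and for the value minus infinity, which is sent to 0,
    the strict inequality would be no contradiction.\<close>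
  moreover have "\<bar>u (0, 0)\<bar> \<noteq> \<infinity>"
    using assms(4)[of 0 0] assms(2) unfolding has_partial_x_def has_finite_derivative_def
    by (auto dest: eventually_nhds_x_imp_x)
  ultimately show False by (cases "u (0, 0)") (auto simp: v_def g_def)
qed

end
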